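(* For every finite graph $G$, $\mathrm{stw}(G) \leq \mathrm{ctww}(G) - 1$. Consequently, $\mathrm{stw}(G) \leq 2(\mathrm{cw}(G) - 1)$, where $\mathrm{cw}(G)$ is the clique-width of $G$.
   Context: All graphs are finite and simple. A partition sequence of an $n$-vertex graph $G$ is a sequence $\mathcal P_n,\dots,\mathcal P_1$ of partitions of $V(G)$ such that $\mathcal P_n$ is the partition into singletons, $\mathcal P_1=\{V(G)\}$, and for each $i<n$, $\mathcal P_i$ is obtained from $\mathcal P_{i+1}$ by merging two parts into their union. Two distinct parts $X,Y$ of a partition are inhomogeneous if there are $u,u'\in X$, $v,v'\in Y$ with $uv\in E(G)$ and $u'v'\notin E(G)$. The red graph $\mathcal R(\mathcal P)$ of a partition $\mathcal P$ has vertex set $\mathcal P$ and an edge between any two inhomogeneous parts. The component twin-width $\mathrm{ctww}(G)$ is the minimum, over all partition sequences of $G$, of the maximum over $i$ of the largest number of vertices (parts) of a connected component of $\mathcal R(\mathcal P_i)$. An ordered graph $(G,\prec)$ is a graph with a strict total order $\prec$ on $V(G)$. For $X\subseteq V(G)$, its span is $\langle X\rangle=\{v : \min X \preceq v\preceq \max X\}$. Two sets $X,Y\subseteq V(G)$ conflict if $\langle X\rangle\cap\langle Y\rangle\neq\emptyset$. For a partition $\mathcal P$ of $V(G)$ and $X\in\mathcal P$, a part $Y\in\mathcal P\setminus\{X\}$ interferes with $X$ if $Y$ conflicts with the union of the parts in the closed neighborhood of $X$ in $\mathcal R(\mathcal P)$. The stretch of $X$ is the number of parts of $\mathcal P$ interfering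 with $X$, and the stretch of $\mathcal P$ is the maximum stretch of its parts. The stretch-width $\mathrm{stw}(G,\prec)$ is the minimum over all partition sequences $\mathcal P_n,\dots,\mathcal P_1$ of $G$ of $\max_i$ (stretch of $\mathcal P_i$), and $\mathrm{stw}(G)$ is the minimum of $\mathrm{stw}(G,\prec)$ over all total orders $\prec$ on $V(G)$. *)

theory Defs
  imports "Graph_Theory.Graph_Theory" "HOL-Library.Disjoint_Sets"
begin

text \<open>
  A finite simple graph is a \<^locale>\<open>pair_graph\<close>: a finite, loop-free digraph with a symmetric arc
  relation, an edge \<open>uv\<close> being the pair of arcs \<open>(u, v)\<close> and \<open>(v, u)\<close>.

  All parameters below are minima of nonempty sets of natural numbers, written as infima in
  \<^typ>\<open>nat\<close>. They are meant for graphs with at least one vertex: the graph without vertices has no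
  partition sequence.
\<close>

section \<open>Partition sequences and red graphs\<close>

text \<open>The sequence is a function on \<^typ>\<open>nat\<close>; only its values on \<open>{1..n}\<close> matter.\<close>

definition partition_sequence :: "'a pair_pre_digraph \<Rightarrow> (nat \<Rightarrow> 'a set set) \<Rightarrow> bool" where
  "partition_sequence G \<P> \<longleftrightarrow>
     (\<forall>i\<in>{1..card (pverts G)}. partition_on (pverts G) (\<P> i)) \<and>
     \<P> (card (pverts G)) = {{v} | v. v \<in> pverts G} \<and>
     \<P> 1 = {pverts G} \<and>
     (\<forall>i\<in>{1..<card (pverts G)}. \<exists>X\<in>\<P> (i + 1). \<exists>Y\<in>\<P> (i + 1).
        X \<noteq> Y \<and> \<P> i = (\<P> (i + 1) - {X, Y}) \<union> {X \<union> Y})"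

definition inhomogeneous :: "'a pair_pre_digraph \<Rightarrow> 'a set \<Rightarrow> 'a set \<Rightarrow> bool" where
  "inhomogeneous G X Y \<longleftrightarrow>
     X \<noteq> Y \<and> (\<exists>u\<in>X. \<exists>u'\<in>X. \<exists>v\<in>Y. \<exists>v'\<in>Y. (u, v) \<in> parcs G \<and> (u', v') \<notin> parcs G)"

definition red_graph :: "'a pair_pre_digraph \<Rightarrow> 'a set set \<Rightarrow> 'a set pair_pre_digraph" where
  "red_graph G P = \<lparr> pverts = P, parcs = {(X, Y) \<in> P \<times> P. inhomogeneous G X Y} \<rparr>"

lemma pair_graph_red_graph:
  assumes "pair_graph G" "finite P"
  shows "pair_graph (red_graph G P)"
proof -
  interpret pair_graph G by fact
  have arc_sym: "(v, u) \<in> parcs G" if "(u, v) \<in> parcs G" for u v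
    using that graph_symmetric by auto
  have inhom_sym: "inhomogeneous G Y X" if "inhomogeneous G X Y" for X Y
    using that unfolding inhomogeneous_def by (meson arc_sym)
  have "parcs (red_graph G P) \<subseteq> P \<times> P"
    by (auto simp: red_graph_def)
  then have "finite (parcs (red_graph G P))"
    using \<open>finite P\<close> by (meson finite_SigmaI finite_subset)
  moreover have "symmetric (with_proj (red_graph G P))"
    by (auto simp: red_graph_def symmetric_def sym_def intro: inhom_sym)
  moreover have "fst e \<noteq> snd e" if "e \<in> parcs (red_graph G P)" for e
    using that by (auto simp: red_graph_def inhomogeneous_def)
  ultimately show ?thesis
    using \<open>finite P\<close> \<open>parcs (red_graph G P) \<subseteq> P \<times> P\<close>
    by (simp add: pair_graph_def pair_digraph_def pair_pseudo_graph_def pair_fin_digraph_def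
        pair_sym_digraph_def pair_loopfree_digraph_def pair_wf_digraph_def
        pair_fin_digraph_axioms_def pair_sym_digraph_axioms_def pair_loopfree_digraph_axioms_def)
      (auto simp: red_graph_def)
qed

section \<open>Component twin-width\<close>

text \<open>
  Since red graphs are symmetric, their strongly connected components are their connected
  components, and \<^const>\<open>pre_digraph.sccs_verts\<close> yields the vertex sets of the latter.
\<close>

definition max_red_component :: "'a pair_pre_digraph \<Rightarrow> 'a set set \<Rightarrow> nat" where
  "max_red_component G P = Max (card ` pre_digraph.sccs_verts (with_proj (red_graph G P)))"

definition ctww :: "'a pair_pre_digraph \<Rightarrow> nat" where
  "ctww G = (INF \<P> \<in> {\<P>. partition_sequence G \<P>}.
     MAX i\<in>{1..card (pverts G)}. max_red_component G (\<P> i))"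

section \<open>Stretch-width\<close>

text \<open>
  Orders \<open>r\<close> are strict, with \<open>(u, v) \<in> r\<close> for \<open>u \<prec> v\<close>; the reflexive closure \<open>r\<^sup>=\<close> is \<open>\<preceq>\<close>.
  Minimum and maximum are taken of finite nonempty sets of vertices only.
\<close>

definition strict_total_order_on :: "'a set \<Rightarrow> 'a rel \<Rightarrow> bool" where
  "strict_total_order_on V r \<longleftrightarrow> r \<subseteq> V \<times> V \<and> strict_linear_order_on V r"

definition ord_min :: "'a rel \<Rightarrow> 'a set \<Rightarrow> 'a" where
  "ord_min r X = (THE m. m \<in> X \<and> (\<forall>x\<in>X. (m, x) \<in> r\<^sup>=))"

definition ord_max :: "'a rel \<Rightarrow> 'a set \<Rightarrow> 'a" where
  "ord_max r X = (THE m. m \<in> X \<and> (\<forall>x\<in>X. (x, m) \<in> r\<^sup>=))"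

definition ord_span :: "'a pair_pre_digraph \<Rightarrow> 'a rel \<Rightarrow> 'a set \<Rightarrow> 'a set" where
  "ord_span G r X = {v \<in> pverts G. (ord_min r X, v) \<in> r\<^sup>= \<and> (v, ord_max r X) \<in> r\<^sup>=}"

definition conflict :: "'a pair_pre_digraph \<Rightarrow> 'a rel \<Rightarrow> 'a set \<Rightarrow> 'a set \<Rightarrow> bool" where
  "conflict G r X Y \<longleftrightarrow> ord_span G r X \<inter> ord_span G r Y \<noteq> {}"

definition red_closed_nbhd :: "'a pair_pre_digraph \<Rightarrow> 'a set set \<Rightarrow> 'a set \<Rightarrow> 'a set set" where
  "red_closed_nbhd G P X = insert X {Y. (X, Y) \<in> parcs (red_graph G P)}"

definition interferes ::
  "'a pair_pre_digraph \<Rightarrow> 'a rel \<Rightarrow> 'a set set \<Rightarrow> 'a set \<Rightarrow> 'a set \<Rightarrow> bool" where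
  "interferes G r P Y X \<longleftrightarrow> Y \<in> P - {X} \<and> conflict G r Y (\<Union> (red_closed_nbhd G P X))"

definition part_stretch :: "'a pair_pre_digraph \<Rightarrow> 'a rel \<Rightarrow> 'a set set \<Rightarrow> 'a set \<Rightarrow> nat" where
  "part_stretch G r P X = card {Y \<in> P. interferes G r P Y X}"

definition stretch :: "'a pair_pre_digraph \<Rightarrow> 'a rel \<Rightarrow> 'a set set \<Rightarrow> nat" where
  "stretch G r P = (MAX X\<in>P. part_stretch G r P X)"

definition ordered_stw :: "'a pair_pre_digraph \<Rightarrow> 'a rel \<Rightarrow> nat" where
  "ordered_stw G r = (INF \<P> \<in> {\<P>. partition_sequence G \<P>}.
     MAX i\<in>{1..card (pverts G)}. stretch G r (\<P> i))"

definition stw :: "'a pair_pre_digraph \<Rightarrow> nat" where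
  "stw G = (INF r \<in> {r. strict_total_order_on (pverts G) r}. ordered_stw G r)"

section \<open>Clique-width\<close>

text \<open>
  Clique-width expressions: create a vertex with a label, take the disjoint union, join every
  vertex labelled \<open>i\<close> to every vertex labelled \<open>j\<close> (for \<open>i \<noteq> j\<close>), change every label \<open>i\<close> to \<open>j\<close>.
  Vertices carry their names, so that an expression denotes a graph on the nose instead of up to
  isomorphism; the operands of a union must then have no vertex in common.
\<close>

datatype 'a cw_expr =
    Vertex 'a nat
  | Disjoint_Union "'a cw_expr" "'a cw_expr"
  | Join nat nat "'a cw_expr"
  | Relabel nat nat "'a cw_expr"

primrec cw_verts :: "'a cw_expr \<Rightarrow> 'a set" where
  "cw_verts (Vertex v i) = {v}"
| "cw_verts (Disjoint_Union s t) = cw_verts s \<union> cw_verts t"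
| "cw_verts (Join i j t) = cw_verts t"
| "cw_verts (Relabel i j t) = cw_verts t"

text \<open>The label of a vertex; irrelevant outside \<^term>\<open>cw_verts t\<close>.\<close>

primrec cw_label :: "'a cw_expr \<Rightarrow> 'a \<Rightarrow> nat" where
  "cw_label (Vertex v i) = (\<lambda>x. i)"
| "cw_label (Disjoint_Union s t) = (\<lambda>x. if x \<in> cw_verts s then cw_label s x else cw_label t x)"
| "cw_label (Join i j t) = cw_label t"
| "cw_label (Relabel i j t) = (\<lambda>x. if cw_label t x = i then j else cw_label t x)"

primrec cw_arcs :: "'a cw_expr \<Rightarrow> 'a rel" where
  "cw_arcs (Vertex v i) = {}"
| "cw_arcs (Disjoint_Union s t) = cw_arcs s \<union> cw_arcs t"
| "cw_arcs (Join i j t) = cw_arcs t \<union>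
     {(u, v) \<in> cw_verts t \<times> cw_verts t.
        cw_label t u = i \<and> cw_label t v = j \<or> cw_label t u = j \<and> cw_label t v = i}"
| "cw_arcs (Relabel i j t) = cw_arcs t"

definition cw_graph :: "'a cw_expr \<Rightarrow> 'a pair_pre_digraph" where
  "cw_graph t = \<lparr> pverts = cw_verts t, parcs = cw_arcs t \<rparr>"

primrec k_expression :: "nat \<Rightarrow> 'a cw_expr \<Rightarrow> bool" where
  "k_expression k (Vertex v i) \<longleftrightarrow> i \<in> {1..k}"
| "k_expression k (Disjoint_Union s t) \<longleftrightarrow>
     k_expression k s \<and> k_expression k t \<and> cw_verts s \<inter> cw_verts t = {}"
| "k_expression k (Join i j t) \<longleftrightarrow> i \<in> {1..k} \<and> j \<in> {1..k} \<and> i \<noteq> j \<and> k_expression k t"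
| "k_expression k (Relabel i j t) \<longleftrightarrow> i \<in> {1..k} \<and> j \<in> {1..k} \<and> k_expression k t"

definition clique_width :: "'a pair_pre_digraph \<Rightarrow> nat" where
  "clique_width G = Inf {k. \<exists>t. k_expression k t \<and> cw_graph t = G}"

end

theory Submission
  imports Defs
begin

text \<open>
  Along a partition sequence, the vertex sets covered by the red components only grow, so some total
  order makes all of them intervals. For this order, a part can only interfere with \<open>X\<close> if it lies in
  the red component of \<open>X\<close>, and \<open>X\<close> itself does not count.

  For clique-width, follow a \<open>k\<close>-expression bottom-up and merge the vertices of equal label. Equally
  labelled vertices of a subexpression have the same neighbours outside it, so red edges stay within
  a subexpression, and red components exceed \<open>k\<close> parts only while the at most \<open>2k\<close> label classes
  of the two operands of a union are merged into at most \<open>k\<close> classes. The first merge leaves at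
  most \<open>2k - 1\<close> parts.
\<close>

section \<open>Orders\<close>

text \<open>
  Writing the nested classes of a vertex, coarsest first, as the digits of a number gives a key
  whose leading digits are constant exactly on the classes of the corresponding partition.
\<close>

lemma refining_colourings_convex_order:
  fixes c :: "nat \<Rightarrow> 'a \<Rightarrow> 'b"
  assumes fin: "finite V"
    and refines: "\<And>i u v. \<lbrakk>i \<in> {1..<n}; u \<in> V; v \<in> V; c (i + 1) u = c (i + 1) v\<rbrakk> \<Longrightarrow> c i u = c i v"
    and inj: "inj_on (c n) V"
    and n: "n \<ge> 1"
  shows "\<exists>r. strict_total_order_on V r \<and>
    (\<forall>i\<in>{1..n}. \<forall>u v w. (u, v) \<in> r\<^sup>= \<and> (v, w) \<in> r\<^sup>= \<and> c i u = c i w \<longrightarrow> c i v = c i u)"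
proof -
  have "finite (\<Union>i\<in>{1..n}. c i ` V)" using fin by simp
  then obtain h :: "'b \<Rightarrow> nat" where h: "inj_on h (\<Union>i\<in>{1..n}. c i ` V)"
    using finite_imp_inj_to_nat_seg by metis
  have "finite (h ` (\<Union>i\<in>{1..n}. c i ` V))" using fin by simp
  then obtain B where B0: "\<forall>x \<in> h ` (\<Union>i\<in>{1..n}. c i ` V). x < B"
    using finite_nat_set_iff_bounded by metis
  have B: "h (c i v) < B" if "i \<in> {1..n}" "v \<in> V" for i v
    using B0 that by blast
  have h_eq: "c i u = c i v" if "h (c i u) = h (c i v)" "i \<in> {1..n}" "u \<in> V" "v \<in> V" for i u v
    using h that unfolding inj_on_def by blast
  \<comment> \<open>\<open>K i v\<close> has the base-\<open>B\<close> digits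
    \<open>h (c 1 v)\<close>, ..., \<open>h (c i v)\<close>, most significant first.\<close>
  define K where "K = rec_nat (\<lambda>v. 0) (\<lambda>i f v. f v * B + h (c (Suc i) v))"
  have K0: "K 0 v = 0" and KS: "K (Suc i) v = K i v * B + h (c (Suc i) v)" for i v
    by (simp_all add: K_def)
  have Kdiv: "K i v = K (Suc i) v div B" and Kmod: "h (c (Suc i) v) = K (Suc i) v mod B"
    if "Suc i \<le> n" "v \<in> V" for i v
    using B[of "Suc i" v] that by (auto simp: KS)
  \<comment> \<open>Division by \<open>B\<close> drops the last digit and is monotone, so a weak
    inequality of \<open>K n\<close> passes to every prefix \<open>K i\<close>.\<close>
  have mono: "K i u \<le> K i v" if "i \<le> n" "K n u \<le> K n v" "u \<in> V" "v \<in> V" for i u v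
    using that(1,2)
  proof (induction i rule: inc_induct)
    case (step i)
    then show ?case using Kdiv[of i u] Kdiv[of i v] that(3,4) by (simp add: div_le_mono)
  qed simp
  have K_imp: "c i u = c i v" if "i \<in> {1..n}" "K i u = K i v" "u \<in> V" "v \<in> V" for i u v
  proof -
    have "i = Suc (i - 1)" using that(1) by simp
    then obtain j where "i = Suc j" by blast
    then show ?thesis using Kmod[of j u] Kmod[of j v] h_eq[of i u v] that by auto
  qed
  \<comment> \<open>Equal colours at level \<open>i\<close> force equal colours at all coarser
    levels, hence equality of all digits.\<close>
  have imp_K: "K i u = K i v" if "i \<in> {1..n}" "c i u = c i v" "u \<in> V" "v \<in> V" for i u v
    using that(1,2)
  proof (induction i)
    case (Suc i)
    show ?case
    proof (cases "i = 0")
      case False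
      then show ?thesis using Suc refines[of i u v] that(3,4) by (auto simp: KS)
    qed (use Suc in \<open>auto simp: KS K0\<close>)
  qed simp
  define r where "r = {(u, v) \<in> V \<times> V. K n u < K n v}"
  have "strict_total_order_on V r"
  proof -
    have "(u, v) \<in> r \<or> (v, u) \<in> r" if "u \<in> V" "v \<in> V" "u \<noteq> v" for u v
    proof -
      have "K n u \<noteq> K n v" using K_imp[of n u v] that inj n by (auto simp: inj_on_def)
      then show ?thesis using that by (auto simp: r_def)
    qed
    then show ?thesis
      unfolding strict_total_order_on_def strict_linear_order_on_def
      by (auto simp: trans_def irrefl_def total_on_def r_def)
  qed
  moreover have "c i v = c i u"
    if i: "i \<in> {1..n}" and r: "(u, v) \<in> r\<^sup>=" "(v, w) \<in> r\<^sup>=" and eq: "c i u = c i w" for i u v w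
  \<comment> \<open>Points outside \<open>V\<close> are related only to themselves, where the claim
    is trivial. Otherwise \<open>K i v\<close> is squeezed between the equal numbers
    \<open>K i u\<close> and \<open>K i w\<close>.\<close>
  proof (cases "u = v \<or> v = w")
    case False
    then have V: "u \<in> V" "v \<in> V" "w \<in> V" and le: "K n u \<le> K n v" "K n v \<le> K n w"
      using r by (auto simp: r_def)
    have "K i u \<le> K i v" "K i v \<le> K i w" using mono V le i by auto
    moreover have "K i u = K i w" using imp_K i eq V by blast
    ultimately show ?thesis using K_imp[of i v u] i V by auto
  qed (use eq in auto)
  ultimately show ?thesis by blast
qed

lemma strict_total_order_onD:
  assumes "strict_total_order_on V r"
  shows "trans r" "irrefl r" "\<And>u v. \<lbrakk>u \<in> V; v \<in> V; u \<noteq> v\<rbrakk> \<Longrightarrow> (u, v) \<in> r \<or> (v, u) \<in> r"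
  using assms by (auto simp: strict_total_order_on_def strict_linear_order_on_def total_on_def)

lemma strict_total_order_on_converse:
  "strict_total_order_on V r \<Longrightarrow> strict_total_order_on V (r\<inverse>)"
  by (auto simp: strict_total_order_on_def strict_linear_order_on_def irrefl_def total_on_def)

lemma strict_total_order_on_least:
  assumes r: "strict_total_order_on V r" and "finite X" "X \<noteq> {}" "X \<subseteq> V"
  shows "\<exists>!m. m \<in> X \<and> (\<forall>x\<in>X. (m, x) \<in> r\<^sup>=)"
proof -
  note rD = strict_total_order_onD[OF r]
  have "\<exists>m. m \<in> X \<and> (\<forall>x\<in>X. (m, x) \<in> r\<^sup>=)" using assms(2-4)
  proof (induction rule: finite_ne_induct)
    case (insert x F)
    then obtain m where m: "m \<in> F" "\<forall>y\<in>F. (m, y) \<in> r\<^sup>=" by auto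
    show ?case
    proof (cases "(m, x) \<in> r")
      case True
      then show ?thesis using m by blast
    next
      case False
      then have "(x, m) \<in> r" using rD(3)[of x m] insert m by auto
      then have "(x, y) \<in> r" if "y \<in> F" for y
        using m that rD(1) by (auto dest: transD)
      then show ?thesis by blast
    qed
  qed simp
  moreover have "m = m'" if "m \<in> X" "m' \<in> X" "(m, m') \<in> r\<^sup>=" "(m', m) \<in> r\<^sup>=" for m m'
    using that rD(1,2) by (auto simp: irrefl_def dest: transD)
  ultimately show ?thesis by blast
qed

lemma ord_min_in:
  assumes "strict_total_order_on V r" "finite X" "X \<noteq> {}" "X \<subseteq> V"
  shows "ord_min r X \<in> X"
  using theI'[OF strict_total_order_on_least[OF assms]] unfolding ord_min_def by blast

lemma ord_max_in:
  assumes "strict_total_order_on V r" "finite X" "X \<noteq> {}" "X \<subseteq> V"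
  shows "ord_max r X \<in> X"
proof -
  \<comment> \<open>Reversing the order turns the description of a maximum into that of a
    minimum.\<close>
  have "ord_max r X = ord_min (r\<inverse>) X"
    unfolding ord_max_def ord_min_def by (rule arg_cong[where f = The]) auto
  then show ?thesis
    using ord_min_in[OF strict_total_order_on_converse[OF assms(1)] assms(2-)] by simp
qed

section \<open>Red components along a partition sequence\<close>

lemma parcs_red_graph:
  "(X, Y) \<in> parcs (red_graph G P) \<longleftrightarrow> X \<in> P \<and> Y \<in> P \<and> inhomogeneous G X Y"
  by (simp add: red_graph_def)

lemma pverts_red_graph [simp]: "pverts (red_graph G P) = P"
  by (simp add: red_graph_def)

lemma pair_graph_arc_sym: "pair_graph G \<Longrightarrow> (u, v) \<in> parcs G \<Longrightarrow> (v, u) \<in> parcs G"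
proof -
  assume "pair_graph G" and uv: "(u, v) \<in> parcs G"
  then interpret pair_graph G by simp
  show ?thesis using uv graph_symmetric by auto
qed

lemma pair_graph_finite: "pair_graph G \<Longrightarrow> finite (pverts G)"
  by (simp add: pair_graph_def pair_digraph_def pair_fin_digraph_def pair_fin_digraph_axioms_def)

lemma pair_graph_no_loop: "pair_graph G \<Longrightarrow> (u, u) \<notin> parcs G"
  using pair_loopfree_digraph.pair_no_loops[of G "(u, u)"]
  by (auto simp: pair_graph_def pair_digraph_def)

lemma pair_graph_arcs: "pair_graph G \<Longrightarrow> parcs G \<subseteq> pverts G \<times> pverts G"
  by (force simp: pair_graph_def pair_digraph_def pair_fin_digraph_def pair_wf_digraph_def)

lemma inhomogeneous_sym:
  "pair_graph G \<Longrightarrow> inhomogeneous G X Y \<Longrightarrow> inhomogeneous G Y X"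
  unfolding inhomogeneous_def by (meson pair_graph_arc_sym)

section \<open>Red components as reachability classes\<close>

definition red_component :: "'a pair_pre_digraph \<Rightarrow> 'a set set \<Rightarrow> 'a set \<Rightarrow> 'a set set" where
  "red_component G P X = {Y. (X, Y) \<in> (parcs (red_graph G P))\<^sup>*}"

lemma red_component_self: "X \<in> red_component G P X"
  by (simp add: red_component_def)

lemma red_component_subset: "X \<in> P \<Longrightarrow> red_component G P X \<subseteq> P"
  unfolding red_component_def by (auto elim: rtranclE simp: parcs_red_graph)

lemma red_rtrancl_sym:
  assumes "pair_graph G" "(X, Y) \<in> (parcs (red_graph G P))\<^sup>*"
  shows "(Y, X) \<in> (parcs (red_graph G P))\<^sup>*"
proof -
  have "sym (parcs (red_graph G P))"
    using inhomogeneous_sym[OF assms(1)] by (auto simp: sym_def parcs_red_graph)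
  then show ?thesis using assms(2) by (meson sym_rtrancl symD)
qed

lemma red_component_eq_iff:
  assumes "pair_graph G"
  shows "red_component G P X = red_component G P Y \<longleftrightarrow> (X, Y) \<in> (parcs (red_graph G P))\<^sup>*"
proof
  assume "red_component G P X = red_component G P Y"
  then show "(X, Y) \<in> (parcs (red_graph G P))\<^sup>*" by (auto simp: red_component_def)
next
  assume "(X, Y) \<in> (parcs (red_graph G P))\<^sup>*"
  then show "red_component G P X = red_component G P Y"
    using red_rtrancl_sym[OF assms] unfolding red_component_def by (blast intro: rtrancl_trans)
qed

text \<open>Symmetry makes reachability mutual, so a maximal set of mutually reachable parts is
  everything reachable from any one of its members.\<close>

lemma sccs_verts_red_graph:
  assumes "pair_graph G"
  shows "pre_digraph.sccs_verts (with_proj (red_graph G P)) = red_component G P ` P"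
proof -
  let ?R = "parcs (red_graph G P)"
  have wf: "wf_digraph (with_proj (red_graph G P))"
    by (auto simp: wf_digraph_def red_graph_def)
  have reach: "X \<rightarrow>\<^sup>*\<^bsub>with_proj (red_graph G P)\<^esub> Y \<longleftrightarrow> X \<in> P \<and> Y \<in> P \<and> (X, Y) \<in> ?R\<^sup>*" for X Y
    using wf_digraph.reachable_conv[OF wf, of X Y] by auto
  have refl: "(X, X) \<in> ?R\<^sup>*" for X by simp
  have tr: "(X, Z) \<in> ?R\<^sup>*" if "(X, Y) \<in> ?R\<^sup>*" "(Y, Z) \<in> ?R\<^sup>*" for X Y Z
    using that by (rule rtrancl_trans)
  have sy: "(Y, X) \<in> ?R\<^sup>*" if "(X, Y) \<in> ?R\<^sup>*" for X Y
    using that by (rule red_rtrancl_sym[OF assms])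
  have inP: "Y \<in> P" if "(X, Y) \<in> ?R\<^sup>*" "X \<in> P" for X Y
    using red_component_subset[OF that(2)] that(1) by (auto simp: red_component_def)
  show ?thesis
  proof (intro set_eqI iffI)
    fix S assume "S \<in> pre_digraph.sccs_verts (with_proj (red_graph G P))"
    then have S: "S \<noteq> {}" "\<And>X Y. \<lbrakk>X \<in> S; Y \<in> S\<rbrakk> \<Longrightarrow> X \<in> P \<and> (X, Y) \<in> ?R\<^sup>*"
      and mx: "\<And>X Y. \<lbrakk>X \<in> S; Y \<notin> S; X \<in> P; Y \<in> P; (X, Y) \<in> ?R\<^sup>*\<rbrakk> \<Longrightarrow> (Y, X) \<notin> ?R\<^sup>*"
      unfolding pre_digraph.sccs_verts_def reach by blast+
    obtain X where X: "X \<in> S" using S(1) by blast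
    have XP: "X \<in> P" using S(2)[OF X X] by simp
    have "S = red_component G P X"
      unfolding red_component_def using S(2) mx[OF X] X XP sy inP by blast
    then show "S \<in> red_component G P ` P" using XP by blast
  next
    fix S assume "S \<in> red_component G P ` P"
    then obtain X where X: "X \<in> P" and S: "S = {Y. (X, Y) \<in> ?R\<^sup>*}"
      by (auto simp: red_component_def)
    have "S \<subseteq> P" using X inP S by blast
    then show "S \<in> pre_digraph.sccs_verts (with_proj (red_graph G P))"
      unfolding pre_digraph.sccs_verts_def reach S using X refl tr sy by blast
  qed
qed

lemma max_red_component_eq:
  assumes "pair_graph G"
  shows "max_red_component G P = Max ((\<lambda>X. card (red_component G P X)) ` P)"
  unfolding max_red_component_def sccs_verts_red_graph[OF assms] by (simp add: image_image)

lemma partition_on_finite: "finite V \<Longrightarrow> partition_on V P \<Longrightarrow> finite P"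
  by (metis finite_UnionD partition_onD1)

lemma partition_on_part_eq:
  "\<lbrakk>partition_on V P; X \<in> P; Y \<in> P; v \<in> X; v \<in> Y\<rbrakk> \<Longrightarrow> X = Y"
  by (meson disjoint_iff disjointD partition_onD2)

lemma partition_sequence_partition_on:
  "partition_sequence G \<P> \<Longrightarrow> i \<in> {1..card (pverts G)} \<Longrightarrow> partition_on (pverts G) (\<P> i)"
  by (auto simp: partition_sequence_def)

section \<open>Red components under coarsening\<close>

text \<open>These sets are the colours fed to \<open>refining_colourings_convex_order\<close>.
  Collecting over all parts that contain \<open>v\<close> avoids choosing one; in a partition there
  is only one.\<close>

definition vertex_component :: "'a pair_pre_digraph \<Rightarrow> 'a set set \<Rightarrow> 'a \<Rightarrow> 'a set set" where
  "vertex_component G P v = {Y. \<exists>X\<in>P. v \<in> X \<and> Y \<in> red_component G P X}"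

lemma vertex_component_eq:
  assumes "partition_on V P" "X \<in> P" "v \<in> X"
  shows "vertex_component G P v = red_component G P X"
  using assms partition_on_part_eq[OF assms(1)] unfolding vertex_component_def by blast

text \<open>The four witnesses of inhomogeneity survive when parts grow, so a red path of
  \<open>P\<close> maps to a red walk of \<open>P'\<close>.\<close>

lemma red_component_refines:
  assumes G: "pair_graph G"
    and P: "partition_on V P" "partition_on V P'"
    and ref: "\<And>X. X \<in> P \<Longrightarrow> \<exists>X'\<in>P'. X \<subseteq> X'"
    and uv: "u \<in> V" "v \<in> V" "vertex_component G P u = vertex_component G P v"
  shows "vertex_component G P' u = vertex_component G P' v"
proof -
  obtain X Y where X: "X \<in> P" "u \<in> X" and Y: "Y \<in> P" "v \<in> Y"
    using uv P(1) by (metis UnionE partition_onD1)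
  obtain X' Y' where X': "X' \<in> P'" "X \<subseteq> X'" and Y': "Y' \<in> P'" "Y \<subseteq> Y'"
    using ref X Y by meson
  have nonempty: "Z \<noteq> {}" if "Z \<in> P" for Z
    using P(1) that by (metis partition_onD3)
  have "(X, Y) \<in> (parcs (red_graph G P))\<^sup>*"
    using uv(3) vertex_component_eq[OF P(1) X] vertex_component_eq[OF P(1) Y]
    by (metis red_component_eq_iff[OF G])
  then have "\<forall>Y'\<in>P'. Y \<subseteq> Y' \<longrightarrow> (X', Y') \<in> (parcs (red_graph G P'))\<^sup>*"
  proof (induction rule: rtrancl_induct)
    case base
    have "Y' = X'" if Y': "Y' \<in> P'" "X \<subseteq> Y'" for Y'
      using partition_on_part_eq[OF P(2) Y'(1) X'(1), of u] X(2) X'(2) Y'(2) by blast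
    then show ?case by blast
  next
    case (step Y Z)
    then have YZ: "Y \<in> P" "Z \<in> P" "inhomogeneous G Y Z" by (simp_all add: parcs_red_graph)
    obtain Y' where Y': "Y' \<in> P'" "Y \<subseteq> Y'" using ref YZ by blast
    show ?case
    proof (intro ballI impI)
      fix Z' assume Z': "Z' \<in> P'" "Z \<subseteq> Z'"
      \<comment> \<open>The walk stands still when both ends of a red edge are absorbed by the same
        part.\<close>
      have "(Y', Z') \<in> (parcs (red_graph G P'))\<^sup>="
        using YZ(3) Y' Z' unfolding parcs_red_graph inhomogeneous_def
        by (auto simp: parcs_red_graph inhomogeneous_def)
      then show "(X', Z') \<in> (parcs (red_graph G P'))\<^sup>*"
        using step.IH Y' by (auto intro: rtrancl_into_rtrancl)
    qed
  qed
  then have "(X', Y') \<in> (parcs (red_graph G P'))\<^sup>*" using Y' by blast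
  then show ?thesis
    using vertex_component_eq[OF P(2) X'(1), of u] vertex_component_eq[OF P(2) Y'(1), of v] X X' Y Y'
    by (metis red_component_eq_iff[OF G] subsetD)
qed

text \<open>Inhomogeneity needs both an edge and a non-edge between two parts, but one-vertex parts
  offer only one pair. This makes the finest colouring injective.\<close>

lemma vertex_component_singletons:
  assumes "pair_graph G" "v \<in> V"
  shows "vertex_component G {{v} | v. v \<in> V} v = {{v}}"
proof -
  have "parcs (red_graph G {{v} | v. v \<in> V}) = {}"
    by (auto simp: parcs_red_graph red_graph_def inhomogeneous_def)
  then show ?thesis using assms(2) by (auto simp: vertex_component_def red_component_def)
qed

text \<open>A merge only coarsens the partition, so the colourings by red components refine each
  other. Convexity of a colour class means that the vertices covered by a red component form an
  interval.\<close>

lemma partition_sequence_convex_order: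
  assumes G: "pair_graph G" "pverts G \<noteq> {}" and \<P>: "partition_sequence G \<P>"
  shows "\<exists>r. strict_total_order_on (pverts G) r \<and>
    (\<forall>i\<in>{1..card (pverts G)}. \<forall>u v w. (u, v) \<in> r\<^sup>= \<and> (v, w) \<in> r\<^sup>= \<and>
      vertex_component G (\<P> i) u = vertex_component G (\<P> i) w \<longrightarrow>
      vertex_component G (\<P> i) v = vertex_component G (\<P> i) u)"
proof (rule refining_colourings_convex_order)
  let ?V = "pverts G"
  show "finite ?V" using pair_graph_finite G by blast
  then show "card ?V \<ge> 1" using G(2) by (simp add: Suc_leI card_gt_0_iff)
  have "\<P> (card ?V) = {{v} | v. v \<in> ?V}" using \<P> by (simp add: partition_sequence_def)
  then show "inj_on (\<lambda>v. vertex_component G (\<P> (card ?V)) v) ?V"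
    using vertex_component_singletons[OF G(1), of _ ?V] by (auto simp: inj_on_def)
next
  fix i u v
  assume i: "i \<in> {1..<card (pverts G)}" and uv: "u \<in> pverts G" "v \<in> pverts G"
    "vertex_component G (\<P> (i + 1)) u = vertex_component G (\<P> (i + 1)) v"
  obtain X Y where XY: "\<P> i = \<P> (i + 1) - {X, Y} \<union> {X \<union> Y}"
    using \<P> i unfolding partition_sequence_def by meson
  show "vertex_component G (\<P> i) u = vertex_component G (\<P> i) v"
  proof (rule red_component_refines[OF G(1) _ _ _ uv])
    show "\<exists>Z'\<in>\<P> i. Z \<subseteq> Z'" if "Z \<in> \<P> (i + 1)" for Z
      using that unfolding XY by (cases "Z \<in> {X, Y}") auto
  qed (use i partition_sequence_partition_on[OF \<P>] in simp_all)
qed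

section \<open>Bounding the stretch by the size of red components\<close>

lemma ord_span_subset:
  assumes r: "strict_total_order_on (pverts G) r" and X: "X \<noteq> {}" "X \<subseteq> U"
    and U: "U \<subseteq> pverts G" "finite U"
    and conv: "\<And>u v w. \<lbrakk>u \<in> U; w \<in> U; (u, v) \<in> r\<^sup>=; (v, w) \<in> r\<^sup>=\<rbrakk> \<Longrightarrow> v \<in> U"
  shows "ord_span G r X \<subseteq> U"
proof -
  have "finite X" "X \<subseteq> pverts G" using X U by (auto intro: finite_subset)
  then have "ord_min r X \<in> U" "ord_max r X \<in> U"
    using ord_min_in[OF r _ X(1)] ord_max_in[OF r _ X(1)] X(2) by auto
  then show ?thesis unfolding ord_span_def using conv by blast
qed

text \<open>The closed red neighbourhood of \<open>X\<close> stays in the interval of the component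
  of \<open>X\<close>, and a part \<open>Y\<close> stays in that of its own component. Distinct
  components have disjoint intervals, so an interfering \<open>Y\<close> shares the component of
  \<open>X\<close>. The inequality is strict because \<open>X\<close> does not interfere with
  itself.\<close>

lemma part_stretch_less_red_component:
  assumes G: "pair_graph G" and r: "strict_total_order_on (pverts G) r"
    and P: "partition_on (pverts G) P" and X: "X \<in> P"
    and conv: "\<And>u v w. \<lbrakk>(u, v) \<in> r\<^sup>=; (v, w) \<in> r\<^sup>=;
      vertex_component G P u = vertex_component G P w\<rbrakk> \<Longrightarrow>
      vertex_component G P v = vertex_component G P u"
  shows "part_stretch G r P X < card (red_component G P X)"
proof -
  have fV: "finite (pverts G)" using pair_graph_finite G by blast
  have fP: "finite P" using fV P by (rule partition_on_finite)
  \<comment> \<open>\<open>U Z\<close> is the interval of vertices covered by the red component of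
    \<open>Z\<close>.\<close>
  define U where "U Z = {v \<in> pverts G. vertex_component G P v = red_component G P Z}" for Z
  have conv_U: "v \<in> U Z" if "u \<in> U Z" "w \<in> U Z" "(u, v) \<in> r\<^sup>=" "(v, w) \<in> r\<^sup>=" for u v w Z
  proof -
    have "v \<in> pverts G"
      using that r by (auto simp: U_def strict_total_order_on_def)
    moreover have "vertex_component G P v = vertex_component G P u"
      using conv[OF that(3,4)] that(1,2) by (auto simp: U_def)
    ultimately show ?thesis using that(1) by (auto simp: U_def)
  qed
  have part_U: "Y \<subseteq> U Z" if "Y \<in> P" "Y \<in> red_component G P Z" for Y Z
  proof
    fix v assume v: "v \<in> Y"
    have "red_component G P Y = red_component G P Z"
      using that(2) red_component_eq_iff[OF G, of P Z Y] by (simp add: red_component_def)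
    moreover have "v \<in> pverts G" using v that(1) P by (metis UnionI partition_onD1)
    ultimately show "v \<in> U Z" using vertex_component_eq[OF P that(1) v] by (simp add: U_def)
  qed
  have span: "ord_span G r A \<subseteq> U Z" if "A \<noteq> {}" "A \<subseteq> U Z" for A Z
  proof (rule ord_span_subset[OF r that])
    show "U Z \<subseteq> pverts G" by (auto simp: U_def)
    then show "finite (U Z)" using fV by (rule finite_subset)
  qed (fact conv_U)
  have nonempty: "Z \<noteq> {}" if "Z \<in> P" for Z
    using P that by (metis partition_onD3)
  have nb: "\<Union> (red_closed_nbhd G P X) \<subseteq> U X"
  proof -
    have "red_closed_nbhd G P X \<subseteq> red_component G P X"
      by (auto simp: red_closed_nbhd_def red_component_def)
    then show ?thesis using part_U red_component_subset[OF X, of G] by blast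
  qed
  have nbne: "\<Union> (red_closed_nbhd G P X) \<noteq> {}"
    using nonempty[OF X] by (auto simp: red_closed_nbhd_def)
  have "{Y \<in> P. interferes G r P Y X} \<subseteq> red_component G P X - {X}"
  proof
    fix Y assume "Y \<in> {Y \<in> P. interferes G r P Y X}"
    then have Y: "Y \<in> P" "Y \<noteq> X" and "conflict G r Y (\<Union> (red_closed_nbhd G P X))"
      by (auto simp: interferes_def)
    \<comment> \<open>Spans do not leave their intervals, so the conflict yields a vertex in both
      intervals; its colour identifies the two components.\<close>
    then obtain v where "v \<in> U Y" "v \<in> U X"
      using span[OF nbne nb] span[OF nonempty[OF Y(1)] part_U[OF Y(1) red_component_self]]
      unfolding conflict_def by blast
    then have "red_component G P X = red_component G P Y" by (auto simp: U_def)
    then show "Y \<in> red_component G P X - {X}" using red_component_self Y by blast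
  qed
  moreover have "finite (red_component G P X)"
    using red_component_subset[OF X] fP finite_subset by blast
  ultimately have "part_stretch G r P X \<le> card (red_component G P X - {X})"
    unfolding part_stretch_def by (meson card_mono finite_Diff)
  also have "\<dots> < card (red_component G P X)"
    using \<open>finite (red_component G P X)\<close> red_component_self by (metis card_Diff1_less)
  finally show ?thesis .
qed

text \<open>A sequence optimal for \<open>ctww\<close> is used for \<open>stw\<close> too, with the
  order that it induces. The assumption \<open>ex\<close> makes the infimum in \<open>ctww\<close>
  attained; in \<open>theorem1\<close> it comes from a clique-width expression.\<close>

lemma stw_less_ctww:
  assumes G: "pair_graph G" "pverts G \<noteq> {}" and ex: "\<exists>\<P>. partition_sequence G \<P>"
  shows "stw G < ctww G"
proof -
  let ?n = "card (pverts G)"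
  have fV: "finite (pverts G)" using pair_graph_finite G by blast
  then have n: "?n \<ge> 1" using G(2) by (simp add: Suc_leI card_gt_0_iff)
  have "ctww G \<in> (\<lambda>\<P>. MAX i\<in>{1..?n}. max_red_component G (\<P> i)) ` {\<P>. partition_sequence G \<P>}"
    unfolding ctww_def by (rule Inf_nat_def1) (use ex in auto)
  then obtain \<P> where \<P>: "partition_sequence G \<P>"
    and c: "ctww G = (MAX i\<in>{1..?n}. max_red_component G (\<P> i))" by blast
  obtain r where r: "strict_total_order_on (pverts G) r"
    and conv: "\<And>i u v w. \<lbrakk>i \<in> {1..?n}; (u, v) \<in> r\<^sup>=; (v, w) \<in> r\<^sup>=;
      vertex_component G (\<P> i) u = vertex_component G (\<P> i) w\<rbrakk> \<Longrightarrow>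
      vertex_component G (\<P> i) v = vertex_component G (\<P> i) u"
    using partition_sequence_convex_order[OF G \<P>] by meson
  have "stretch G r (\<P> i) < ctww G" if i: "i \<in> {1..?n}" for i
  proof -
    note P = partition_sequence_partition_on[OF \<P> i]
    have fP: "finite (\<P> i)" using fV P by (rule partition_on_finite)
    have "part_stretch G r (\<P> i) X < ctww G" if X: "X \<in> \<P> i" for X
    proof -
      have "part_stretch G r (\<P> i) X < card (red_component G (\<P> i) X)"
        by (rule part_stretch_less_red_component[OF G(1) r P X]) (rule conv[OF i])
      also have "\<dots> \<le> max_red_component G (\<P> i)"
        unfolding max_red_component_eq[OF G(1)] using fP X by simp
      also have "\<dots> \<le> ctww G" unfolding c using i by simp
      finally show ?thesis .
    qed
    moreover have "\<P> i \<noteq> {}" using P G(2) by (auto simp: partition_on_def)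
    ultimately show ?thesis unfolding stretch_def using fP by simp
  qed
  then have "(MAX i\<in>{1..?n}. stretch G r (\<P> i)) < ctww G" using n by simp
  moreover have "ordered_stw G r \<le> (MAX i\<in>{1..?n}. stretch G r (\<P> i))"
    unfolding ordered_stw_def using \<P> by (intro cINF_lower) auto
  moreover have "stw G \<le> ordered_stw G r"
    unfolding stw_def using r by (intro cINF_lower) auto
  ultimately show ?thesis by linarith
qed

section \<open>Merging label classes\<close>

definition merges_to :: "'a set set \<Rightarrow> 'a set set \<Rightarrow> bool" where
  "merges_to P P' \<longleftrightarrow> (\<exists>X\<in>P. \<exists>Y\<in>P. X \<noteq> Y \<and> P' = P - {X, Y} \<union> {X \<union> Y})"

text \<open>For symmetric red graphs these are the unions of red components, so a small red-closed
  set around a part certifies that its component is small.\<close>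

definition red_closed :: "'a pair_pre_digraph \<Rightarrow> 'a set set \<Rightarrow> 'a set set \<Rightarrow> bool" where
  "red_closed G P C \<longleftrightarrow> C \<subseteq> P \<and> (\<forall>A\<in>C. \<forall>B\<in>P. inhomogeneous G A B \<longrightarrow> B \<in> C)"

text \<open>The vertices of \<open>X\<close> are twins as seen from outside
  \<open>W\<close>.\<close>

definition outward_homogeneous :: "'a pair_pre_digraph \<Rightarrow> 'a set \<Rightarrow> 'a set \<Rightarrow> bool" where
  "outward_homogeneous G W X \<longleftrightarrow>
     (\<forall>u\<in>X. \<forall>u'\<in>X. \<forall>w\<in>pverts G - W. (u, w) \<in> parcs G \<longleftrightarrow> (u', w) \<in> parcs G)"

text \<open>Besides the bound on red components, homogeneity towards the outside is required so that
  partitions of disjoint sets can be combined without new red edges.\<close>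

definition admissible :: "'a pair_pre_digraph \<Rightarrow> nat \<Rightarrow> 'a set \<Rightarrow> 'a set set \<Rightarrow> bool" where
  "admissible G m W P \<longleftrightarrow> partition_on W P \<and>
     (\<forall>X\<in>P. outward_homogeneous G W X \<and> (\<exists>C. red_closed G P C \<and> X \<in> C \<and> finite C \<and> card C \<le> m))"

text \<open>Admissibility is imposed on the target of each step only, so a path may start at a
  partition with too many parts.\<close>

definition merge_path :: "'a pair_pre_digraph \<Rightarrow> nat \<Rightarrow> 'a set \<Rightarrow> 'a set set \<Rightarrow> 'a set set \<Rightarrow> bool" where
  "merge_path G m W = (\<lambda>P P'. merges_to P P' \<and> admissible G m W P')\<^sup>*\<^sup>*"

lemma outward_homogeneous_subset:
  "outward_homogeneous G W X \<Longrightarrow> Y \<subseteq> X \<Longrightarrow> W \<subseteq> W' \<Longrightarrow> outward_homogeneous G W' Y"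
  unfolding outward_homogeneous_def by blast

lemma merges_to_partition_on:
  assumes P: "partition_on W P" and m: "merges_to P P'"
  shows "partition_on W P'" "finite P \<Longrightarrow> card P = Suc (card P')"
proof -
  obtain X Y where XY: "X \<in> P" "Y \<in> P" "X \<noteq> Y" and P': "P' = P - {X, Y} \<union> {X \<union> Y}"
    using m by (auto simp: merges_to_def)
  have ne: "X \<noteq> {}" "Y \<noteq> {}" using P XY partition_onD3 by auto
  have dj: "A \<inter> B = {}" if "A \<in> P" "B \<in> P" "A \<noteq> B" for A B
    using P that by (meson disjointD partition_onD2)
  show "partition_on W P'"
  proof (rule partition_onI)
    show "\<Union> P' = W" using partition_onD1[OF P] XY P' by blast
    show "{} \<notin> P'" using P ne P' partition_onD3 by auto
    fix A B assume AB: "A \<in> P'" "B \<in> P'" "A \<noteq> B"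
    have "Z \<inter> (X \<union> Y) = {}" if "Z \<in> P - {X, Y}" for Z
      using dj[of Z X] dj[of Z Y] that XY by blast
    then have "A \<inter> B = {}" if "A = X \<union> Y \<or> B = X \<union> Y"
      using that AB unfolding P' by (metis Un_iff inf_commute singletonD)
    moreover have "A \<inter> B = {}" if "A \<noteq> X \<union> Y" "B \<noteq> X \<union> Y"
      using that AB dj[of A B] unfolding P' by simp
    ultimately show "disjnt A B" unfolding disjnt_def by blast
  qed
  \<comment> \<open>The union is not already a part, so the number of parts drops by exactly
    one.\<close>
  have "X \<union> Y \<notin> P - {X, Y}"
  proof
    assume "X \<union> Y \<in> P - {X, Y}"
    then have "(X \<union> Y) \<inter> X = {}" using XY dj[of "X \<union> Y" X] by simp
    then show False using ne by blast
  qed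
  moreover assume fin: "finite P"
  moreover have "card (P - {X, Y}) + 2 = card P"
    using XY fin card_mono[of P "{X, Y}"] by (simp add: card_Diff_subset)
  ultimately show "card P = Suc (card P')" unfolding P' by simp
qed

lemma partition_on_disjoint_Un:
  assumes "partition_on V P" "partition_on W Q" "V \<inter> W = {}"
  shows "partition_on (V \<union> W) (P \<union> Q)"
proof (rule partition_onI)
  show "\<Union> (P \<union> Q) = V \<union> W" using assms(1,2) by (simp add: partition_on_def)
  show "{} \<notin> P \<union> Q" using assms(1,2) by (simp add: partition_on_def)
  have "disjnt A B" if "A \<in> P" "B \<in> Q" for A B
    using that assms partition_onD1 unfolding disjnt_def by blast
  then show "disjnt A B" if "A \<in> P \<union> Q" "B \<in> P \<union> Q" "A \<noteq> B" for A B
    using that assms(1,2) by (metis Un_iff disjnt_sym pairwiseD partition_on_def)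
qed

text \<open>No red edge joins the two sides: given an edge \<open>uv\<close> across,
  \<open>u\<close> may be replaced by \<open>u'\<close> because \<open>v\<close> lies outside
  \<open>W1\<close>, then \<open>v\<close> by \<open>v'\<close> because \<open>u'\<close> lies
  outside \<open>W2\<close>. Hence red-closed sets of either side remain red-closed.\<close>

lemma admissible_union:
  assumes G: "pair_graph G" and W: "W1 \<subseteq> pverts G" "W2 \<subseteq> pverts G" "W1 \<inter> W2 = {}"
    and P: "admissible G m W1 P1" "admissible G m W2 P2"
  shows "admissible G m (W1 \<union> W2) (P1 \<union> P2)"
proof -
  have part: "partition_on W1 P1" "partition_on W2 P2"
    and hom: "\<And>X. X \<in> P1 \<Longrightarrow> outward_homogeneous G W1 X" "\<And>X. X \<in> P2 \<Longrightarrow> outward_homogeneous G W2 X"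
    using P by (auto simp: admissible_def)
  have sub: "X \<in> P1 \<Longrightarrow> X \<subseteq> W1" "X \<in> P2 \<Longrightarrow> X \<subseteq> W2" for X
    using partition_onD1[OF part(1)] partition_onD1[OF part(2)] by auto
  have not_inhom: "\<not> inhomogeneous G A B" if A: "A \<in> P1" and B: "B \<in> P2" for A B
  proof
    assume "inhomogeneous G A B"
    then obtain u u' v v' where uv: "u \<in> A" "u' \<in> A" "v \<in> B" "v' \<in> B"
      "(u, v) \<in> parcs G" "(u', v') \<notin> parcs G"
      unfolding inhomogeneous_def by blast
    then have "v \<in> pverts G - W1" "u' \<in> pverts G - W2"
      using sub(1)[OF A] sub(2)[OF B] W by auto
    then have "(u', v) \<in> parcs G" "(v, u') \<in> parcs G \<longleftrightarrow> (v', u') \<in> parcs G"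
      using hom(1)[OF A] hom(2)[OF B] uv unfolding outward_homogeneous_def by blast+
    then show False using uv(6) pair_graph_arc_sym[OF G] by blast
  qed
  have closed: "red_closed G (P1 \<union> P2) C" if "red_closed G P1 C \<or> red_closed G P2 C" for C
    using that not_inhom inhomogeneous_sym[OF G] unfolding red_closed_def by blast
  have "partition_on (W1 \<union> W2) (P1 \<union> P2)"
    using part W(3) by (rule partition_on_disjoint_Un)
  moreover have "outward_homogeneous G (W1 \<union> W2) X" if "X \<in> P1 \<union> P2" for X
    using that hom outward_homogeneous_subset by (metis Un_iff order_refl sup_ge1 sup_ge2)
  moreover have "\<exists>C. red_closed G (P1 \<union> P2) C \<and> X \<in> C \<and> finite C \<and> card C \<le> m"
    if "X \<in> P1 \<union> P2" for X
    using that P closed unfolding admissible_def by (meson Un_iff)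
  ultimately show ?thesis unfolding admissible_def by blast
qed

lemma merge_path_union:
  assumes G: "pair_graph G" and W: "W1 \<subseteq> pverts G" "W2 \<subseteq> pverts G" "W1 \<inter> W2 = {}"
    and path: "merge_path G m W1 P P'" and Q: "admissible G m W2 Q" and P: "partition_on W1 P"
  shows "merge_path G m (W1 \<union> W2) (P \<union> Q) (P' \<union> Q)"
proof -
  \<comment> \<open>The second conjunct keeps the parts of the moving side out of \<open>Q\<close>,
    so that removing the two merged parts leaves \<open>Q\<close> intact.\<close>
  have "merge_path G m (W1 \<union> W2) (P \<union> Q) (P' \<union> Q) \<and> partition_on W1 P'"
    using path[unfolded merge_path_def]
  proof (induction rule: rtranclp_induct)
    case base
    then show ?case using P by (simp add: merge_path_def)
  next
    case (step R R')
    then obtain X Y where XY: "X \<in> R" "Y \<in> R" "X \<noteq> Y" and R': "R' = R - {X, Y} \<union> {X \<union> Y}"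
      by (auto simp: merges_to_def)
    have "Z \<notin> Q" if "Z \<in> R" for Z
    proof -
      have "Z \<subseteq> W1" "Z \<noteq> {}"
        using step.IH that by (auto simp: partition_on_def)
      moreover have "Z' \<subseteq> W2" if "Z' \<in> Q" for Z'
        using Q that by (auto simp: admissible_def partition_on_def)
      ultimately show ?thesis using W(3) by blast
    qed
    then have "R' \<union> Q = R \<union> Q - {X, Y} \<union> {X \<union> Y}" using XY R' by blast
    then have "merges_to (R \<union> Q) (R' \<union> Q)" using XY unfolding merges_to_def by blast
    moreover have "admissible G m (W1 \<union> W2) (R' \<union> Q)"
      using admissible_union[OF G W _ Q] step by blast
    moreover have "partition_on W1 R'" using step by (simp add: admissible_def)
    ultimately show ?case
      using step.IH unfolding merge_path_def by (metis (no_types, lifting) rtranclp.rtrancl_into_rtrancl)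
  qed
  then show ?thesis by blast
qed

text \<open>
  The initial partition may have \<open>m + 1\<close> parts: every \<^emph>\<open>later\<close> one has at most \<open>m\<close>, so all of its
  parts together form a red-closed set of the allowed size.
\<close>

lemma merge_path_coarsening:
  assumes P': "partition_on W P'" and hom: "\<And>X. X \<in> P' \<Longrightarrow> outward_homogeneous G W X"
  shows "\<lbrakk>partition_on W P; finite P; card P \<le> Suc m; \<And>X. X \<in> P \<Longrightarrow> \<exists>X'\<in>P'. X \<subseteq> X'\<rbrakk>
    \<Longrightarrow> merge_path G m W P P'"
proof (induction "card P" arbitrary: P rule: less_induct)
  case less
  have dj: "A = B" if "A \<in> P'" "B \<in> P'" "v \<in> A" "v \<in> B" for A B v
    using partition_on_part_eq[OF P'] that by blast
  show ?case
  \<comment> \<open>While some target part contains two current parts, merging these two keeps the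
    partition finer than the target.\<close>
  proof (cases "\<exists>X\<in>P. \<exists>Y\<in>P. \<exists>Z\<in>P'. X \<noteq> Y \<and> X \<subseteq> Z \<and> Y \<subseteq> Z")
    case True
    then obtain X Y Z where XY: "X \<in> P" "Y \<in> P" "Z \<in> P'" "X \<noteq> Y" "X \<subseteq> Z" "Y \<subseteq> Z" by blast
    define R where "R = P - {X, Y} \<union> {X \<union> Y}"
    have mg: "merges_to P R" using XY unfolding merges_to_def R_def by blast
    note R = merges_to_partition_on[OF less.prems(1) mg]
    have fR: "finite R" using less.prems(2) by (simp add: R_def)
    have ref: "\<exists>X'\<in>P'. A \<subseteq> X'" if "A \<in> R" for A
      using that less.prems(4) XY unfolding R_def by auto
    have cR: "card R \<le> m" using R(2) less.prems by simp
    have "red_closed G R R" by (simp add: red_closed_def)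
    moreover have "outward_homogeneous G W A" if "A \<in> R" for A
      using ref[OF that] hom outward_homogeneous_subset by (metis order_refl)
    ultimately have "admissible G m W R"
      using R(1) fR cR unfolding admissible_def by blast
    moreover have "merge_path G m W R P'"
      using less.hyps[of R] R less.prems(2) fR cR ref by simp
    ultimately show ?thesis
      using mg unfolding merge_path_def by (metis (no_types, lifting) converse_rtranclp_into_rtranclp)
  next
    case False
    have ne: "{} \<notin> P" "{} \<notin> P'" using less.prems(1) P' partition_onD3 by auto
    have cover: "\<exists>X\<in>P. v \<in> X" "\<exists>X\<in>P'. v \<in> X" if "v \<in> W" for v
      using that less.prems(1) P' by (auto simp: partition_on_def)
    have sub: "X \<subseteq> W" if "X \<in> P \<or> X \<in> P'" for X
      using that less.prems(1) P' by (auto simp: partition_on_def)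
    \<comment> \<open>Each target part now contains at most one current part. Since current parts
      cover it without crossing its border, it equals that part.\<close>
    have same: "X = X'" if X: "X \<in> P" "X' \<in> P'" "X \<subseteq> X'" for X X'
    proof
      show "X' \<subseteq> X"
      proof
        fix v assume v: "v \<in> X'"
        then obtain Y where Y: "Y \<in> P" "v \<in> Y" using cover sub X(2) by blast
        then obtain Y' where "Y' \<in> P'" "Y \<subseteq> Y'" using less.prems(4) by blast
        then have "Y \<subseteq> X'" using dj[of Y' X' v] X(2) v Y by blast
        then show "v \<in> X" using False X Y by blast
      qed
    qed fact
    have "P \<subseteq> P'" using same less.prems(4) by blast
    moreover have "P' \<subseteq> P"
    proof
      fix X' assume X': "X' \<in> P'"
      then obtain v where v: "v \<in> X'" using ne by (metis all_not_in_conv)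
      then obtain X where "X \<in> P" "v \<in> X" using cover sub X' by blast
      then show "X' \<in> P" using dj[of X X' v] \<open>P \<subseteq> P'\<close> X' v by blast
    qed
    ultimately show ?thesis by (simp add: merge_path_def)
  qed
qed

section \<open>From merge paths to partition sequences\<close>

text \<open>Every merge loses one part, so numbering the partitions of a path by their cardinality
  gives the indices of a partition sequence.\<close>

lemma merge_path_partition_sequence:
  assumes path: "merge_path G m W P {W}" and P: "admissible G m W P" and W: "finite W"
  shows "\<exists>\<P>. \<P> (card P) = P \<and> \<P> 1 = {W} \<and> card P \<ge> 1 \<and>
    (\<forall>i\<in>{1..card P}. admissible G m W (\<P> i)) \<and> (\<forall>i\<in>{1..<card P}. merges_to (\<P> (i + 1)) (\<P> i))"
  using path[unfolded merge_path_def] P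
proof (induction rule: converse_rtranclp_induct)
  case base
  then show ?case by (intro exI[of _ "\<lambda>_. {W}"]) auto
next
  case (step P R)
  then obtain \<P> where \<P>: "\<P> (card R) = R" "\<P> 1 = {W}" "card R \<ge> 1"
    "\<And>i. i \<in> {1..card R} \<Longrightarrow> admissible G m W (\<P> i)"
    "\<And>i. i \<in> {1..<card R} \<Longrightarrow> merges_to (\<P> (i + 1)) (\<P> i)" by blast
  have "partition_on W P" using step by (simp add: admissible_def)
  then have c: "card P = Suc (card R)"
    using merges_to_partition_on(2) step.hyps(1) W partition_on_finite by blast
  show ?case
  \<comment> \<open>The new first partition has one part more than \<open>R\<close>, so it takes the
    next free index.\<close>
  proof (intro exI[of _ "\<P>(card P := P)"] conjI ballI)
    fix i assume "i \<in> {1..<card P}"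
    then show "merges_to ((\<P>(card P := P)) (i + 1)) ((\<P>(card P := P)) i)"
      using \<P>(1,5)[of] \<P>(5)[of i] c step.hyps(1) by (cases "i = card R") auto
  qed (use \<P> c step in auto)
qed

lemma admissible_max_red_component:
  assumes G: "pair_graph G" and P: "admissible G m W P" "finite P" "P \<noteq> {}"
  shows "max_red_component G P \<le> m"
proof -
  have "card (red_component G P X) \<le> m" if X: "X \<in> P" for X
  proof -
    obtain C where C: "red_closed G P C" "X \<in> C" "finite C" "card C \<le> m"
      using P X unfolding admissible_def by blast
    have "Y \<in> C" if "(X, Y) \<in> (parcs (red_graph G P))\<^sup>*" for Y
      using that by (induction rule: rtrancl_induct)
        (use C in \<open>auto simp: red_closed_def parcs_red_graph\<close>)
    then have "red_component G P X \<subseteq> C" by (auto simp: red_component_def)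
    then show ?thesis using C by (meson card_mono le_trans)
  qed
  then show ?thesis unfolding max_red_component_eq[OF G] using P by simp
qed

section \<open>Clique-width expressions\<close>

lemma cw_arcs_subset: "cw_arcs t \<subseteq> cw_verts t \<times> cw_verts t"
  by (induction t) auto

lemma cw_label_range: "k_expression k t \<Longrightarrow> v \<in> cw_verts t \<Longrightarrow> cw_label t v \<in> {1..k}"
  by (induction t) auto

lemma cw_verts_finite: "finite (cw_verts t)"
  by (induction t) auto

lemma k_expression_pos: "k_expression k t \<Longrightarrow> k \<ge> 1"
  by (induction t) auto

definition label_classes :: "'a cw_expr \<Rightarrow> 'a set set" where
  "label_classes t = (\<lambda>v. {u \<in> cw_verts t. cw_label t u = cw_label t v}) ` cw_verts t"

lemma label_classes_partition_on: "partition_on (cw_verts t) (label_classes t)"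
  by (rule partition_onI) (auto simp: label_classes_def disjnt_def)

lemma label_classes_card:
  assumes "k_expression k t" shows "card (label_classes t) \<le> k" "finite (label_classes t)"
proof -
  have "label_classes t = (\<lambda>l. {u \<in> cw_verts t. cw_label t u = l}) ` cw_label t ` cw_verts t"
    by (auto simp: label_classes_def)
  moreover have "card (cw_label t ` cw_verts t) \<le> k"
    using card_mono[of "{1..k}" "cw_label t ` cw_verts t"] cw_label_range[OF assms]
    by (simp add: image_subset_iff)
  ultimately show "card (label_classes t) \<le> k" "finite (label_classes t)"
    using cw_verts_finite[of t] by (auto intro: order.trans[OF card_image_le])
qed

text \<open>
  The property of a subexpression of an expression for \<open>G\<close> that is inherited from expressions to
  their operands: equally labelled vertices are distinguished only by arcs created already.
\<close>

definition cw_embedded :: "'a pair_pre_digraph \<Rightarrow> 'a cw_expr \<Rightarrow> bool" where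
  "cw_embedded G t \<longleftrightarrow> cw_verts t \<subseteq> pverts G \<and> cw_arcs t \<subseteq> parcs G \<and>
     (\<forall>u\<in>cw_verts t. \<forall>u'\<in>cw_verts t. \<forall>w\<in>pverts G.
        cw_label t u = cw_label t u' \<and> (u, w) \<notin> cw_arcs t \<and> (u', w) \<notin> cw_arcs t \<longrightarrow>
        ((u, w) \<in> parcs G \<longleftrightarrow> (u', w) \<in> parcs G))"

lemma cw_embedded_self: "cw_embedded (cw_graph t) t"
  by (simp add: cw_embedded_def cw_graph_def)

lemma cw_embeddedI:
  assumes "cw_verts t \<subseteq> pverts G" "cw_arcs t \<subseteq> parcs G"
    and "\<And>u u' w. \<lbrakk>u \<in> cw_verts t; u' \<in> cw_verts t; w \<in> pverts G; cw_label t u = cw_label t u';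
      (u, w) \<notin> cw_arcs t; (u', w) \<notin> cw_arcs t\<rbrakk> \<Longrightarrow> (u, w) \<in> parcs G \<longleftrightarrow> (u', w) \<in> parcs G"
  shows "cw_embedded G t"
  unfolding cw_embedded_def
proof (intro conjI ballI impI)
  fix u u' w assume "u \<in> cw_verts t" "u' \<in> cw_verts t" "w \<in> pverts G"
    "cw_label t u = cw_label t u' \<and> (u, w) \<notin> cw_arcs t \<and> (u', w) \<notin> cw_arcs t"
  then show "(u, w) \<in> parcs G \<longleftrightarrow> (u', w) \<in> parcs G" using assms(3) by blast
qed (fact assms)+

lemma cw_embeddedD:
  assumes "cw_embedded G t"
  shows "cw_verts t \<subseteq> pverts G" "cw_arcs t \<subseteq> parcs G"
    and "\<lbrakk>u \<in> cw_verts t; u' \<in> cw_verts t; w \<in> pverts G; cw_label t u = cw_label t u';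
      (u, w) \<notin> cw_arcs t; (u', w) \<notin> cw_arcs t\<rbrakk> \<Longrightarrow> (u, w) \<in> parcs G \<longleftrightarrow> (u', w) \<in> parcs G"
  using assms unfolding cw_embedded_def by blast+

text \<open>A vertex of one operand keeps its label in the union and receives no arcs from the other
  operand.\<close>

lemma cw_embedded_Disjoint_Union:
  assumes emb: "cw_embedded G (Disjoint_Union s t)" and dj: "cw_verts s \<inter> cw_verts t = {}"
  shows "cw_embedded G s" "cw_embedded G t"
proof -
  have other: "(u, w) \<notin> cw_arcs t" if "u \<in> cw_verts s" for u w
    using that dj cw_arcs_subset[of t] by blast
  have other': "u \<notin> cw_verts s" "(u, w) \<notin> cw_arcs s" if "u \<in> cw_verts t" for u w
    using that dj cw_arcs_subset[of s] by blast+
  show "cw_embedded G s"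
  proof (rule cw_embeddedI)
    fix u u' w assume "u \<in> cw_verts s" "u' \<in> cw_verts s" "w \<in> pverts G"
      "cw_label s u = cw_label s u'" "(u, w) \<notin> cw_arcs s" "(u', w) \<notin> cw_arcs s"
    then show "(u, w) \<in> parcs G \<longleftrightarrow> (u', w) \<in> parcs G"
      using cw_embeddedD(3)[OF emb, of u u' w] other by simp
  qed (use cw_embeddedD(1,2)[OF emb] in simp_all)
  show "cw_embedded G t"
  proof (rule cw_embeddedI)
    fix u u' w assume "u \<in> cw_verts t" "u' \<in> cw_verts t" "w \<in> pverts G"
      "cw_label t u = cw_label t u'" "(u, w) \<notin> cw_arcs t" "(u', w) \<notin> cw_arcs t"
    then show "(u, w) \<in> parcs G \<longleftrightarrow> (u', w) \<in> parcs G"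
      using cw_embeddedD(3)[OF emb, of u u' w] other' by simp
  qed (use cw_embeddedD(1,2)[OF emb] in simp_all)
qed

text \<open>The arcs of a join depend on labels alone, so equally labelled vertices are both joined
  to \<open>w\<close> or both not. In the first case both arcs are in \<open>G\<close>; in the
  second the property of the whole expression applies.\<close>

lemma cw_embedded_Join:
  assumes emb: "cw_embedded G (Join i j t)"
  shows "cw_embedded G t"
proof (rule cw_embeddedI)
  let ?t = "Join i j t"
  note * = cw_embeddedD[OF emb]
  fix u u' w
  assume u: "u \<in> cw_verts t" "u' \<in> cw_verts t" "w \<in> pverts G" "cw_label t u = cw_label t u'"
    "(u, w) \<notin> cw_arcs t" "(u', w) \<notin> cw_arcs t"
  then have joined: "(u, w) \<in> cw_arcs ?t \<longleftrightarrow> (u', w) \<in> cw_arcs ?t" by simp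
  show "(u, w) \<in> parcs G \<longleftrightarrow> (u', w) \<in> parcs G"
  proof (cases "(u, w) \<in> cw_arcs ?t")
    case True
    then show ?thesis using joined *(2) by blast
  next
    case False
    then show ?thesis using joined *(3)[of u u' w] u by simp
  qed
qed (use cw_embeddedD(1,2)[OF emb] in simp_all)

lemma cw_embedded_Relabel:
  assumes emb: "cw_embedded G (Relabel i j t)"
  shows "cw_embedded G t"
proof (rule cw_embeddedI)
  fix u u' w
  assume "u \<in> cw_verts t" "u' \<in> cw_verts t" "w \<in> pverts G" "cw_label t u = cw_label t u'"
    "(u, w) \<notin> cw_arcs t" "(u', w) \<notin> cw_arcs t"
  then show "(u, w) \<in> parcs G \<longleftrightarrow> (u', w) \<in> parcs G"
    using cw_embeddedD(3)[OF emb, of u u' w] by simp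
qed (use cw_embeddedD(1,2)[OF emb] in simp_all)

text \<open>Arcs of \<open>t\<close> end inside \<open>cw_verts t\<close>, so for \<open>w\<close>
  outside the premises about existing arcs in \<open>cw_embedded\<close> hold.\<close>

lemma label_classes_outward_homogeneous:
  assumes "cw_embedded G t" "X \<in> label_classes t"
  shows "outward_homogeneous G (cw_verts t) X"
  unfolding outward_homogeneous_def
proof (intro ballI)
  fix u u' w assume u: "u \<in> X" "u' \<in> X" "w \<in> pverts G - cw_verts t"
  then have "(u, w) \<notin> cw_arcs t" "(u', w) \<notin> cw_arcs t"
    using cw_arcs_subset[of t] by blast+
  then show "(u, w) \<in> parcs G \<longleftrightarrow> (u', w) \<in> parcs G"
    using cw_embeddedD(3)[OF assms(1), of u u' w] u assms(2) by (auto simp: label_classes_def)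
qed

section \<open>Contracting a graph along an expression\<close>

definition singletons :: "'a set \<Rightarrow> 'a set set" where
  "singletons W = {{v} | v. v \<in> W}"

lemma singletons_admissible: "m \<ge> 1 \<Longrightarrow> admissible G m W (singletons W)"
  unfolding admissible_def
proof (intro conjI ballI)
  show "partition_on W (singletons W)"
    by (rule partition_onI) (auto simp: singletons_def disjnt_def)
  fix X assume m: "m \<ge> 1" and X: "X \<in> singletons W"
  then show "outward_homogeneous G W X" by (auto simp: singletons_def outward_homogeneous_def)
  have "red_closed G (singletons W) {X}"
    using X by (auto simp: singletons_def red_closed_def inhomogeneous_def)
  then show "\<exists>C. red_closed G (singletons W) C \<and> X \<in> C \<and> finite C \<and> card C \<le> m"
    using m by (intro exI[of _ "{X}"]) simp
qed

lemma merge_path_admissible: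
  "merge_path G m W P P' \<Longrightarrow> admissible G m W P \<Longrightarrow> admissible G m W P'"
  unfolding merge_path_def by (induction rule: rtranclp_induct) auto

lemma merge_path_trans:
  "merge_path G m W P Q \<Longrightarrow> merge_path G m W Q R \<Longrightarrow> merge_path G m W P R"
  unfolding merge_path_def by (rule rtranclp_trans)

text \<open>The value \<open>m = 2k - 1\<close> is chosen so that the at most \<open>2k\<close>
  classes of two operands meet the bound \<open>Suc m\<close> of
  \<open>merge_path_coarsening\<close>. All red edges are taken in the whole graph
  \<open>G\<close>.\<close>

lemma merge_path_label_classes:
  assumes G: "pair_graph G" and m: "2 * k = Suc m"
  shows "k_expression k t \<Longrightarrow> cw_embedded G t \<Longrightarrow>
    merge_path G m (cw_verts t) (singletons (cw_verts t)) (label_classes t)"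
proof (induction t)
  case (Vertex v i)
  have "label_classes (Vertex v i) = singletons {v}"
    by (auto simp: label_classes_def singletons_def)
  then show ?case by (simp add: merge_path_def)
next
  case (Disjoint_Union s t)
  let ?u = "Disjoint_Union s t" and ?S = "cw_verts s" and ?T = "cw_verts t"
  have k: "k_expression k s" "k_expression k t" and dj: "?S \<inter> ?T = {}"
    using Disjoint_Union.prems by simp_all
  note emb = cw_embedded_Disjoint_Union[OF Disjoint_Union.prems(2) dj]
  have m1: "m \<ge> 1" using k_expression_pos[OF k(1)] m by linarith
  have sub: "?S \<subseteq> pverts G" "?T \<subseteq> pverts G" using emb by (auto simp: cw_embedded_def)
  note adm = singletons_admissible[OF m1]
  have path: "merge_path G m ?S (singletons ?S) (label_classes s)"
    "merge_path G m ?T (singletons ?T) (label_classes t)"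
    using Disjoint_Union.IH k emb by blast+
  have part: "partition_on W (singletons W)" for W :: "'a set"
    using adm[of G W] by (simp add: admissible_def)
  have "merge_path G m (?S \<union> ?T) (singletons ?S \<union> singletons ?T) (label_classes s \<union> singletons ?T)"
    by (rule merge_path_union[OF G sub dj path(1) adm part])
  \<comment> \<open>The second operand is contracted while the first rests at its label classes,
    which are admissible as the end of its own path.\<close>
  moreover have "merge_path G m (?S \<union> ?T) (label_classes s \<union> singletons ?T)
      (label_classes s \<union> label_classes t)"
    using merge_path_union[OF G sub(2,1) _ path(2) merge_path_admissible[OF path(1) adm] part] dj
    by (simp add: Un_commute Int_commute)
  \<comment> \<open>Finally, classes of the two operands with a common label are merged.\<close>
  moreover have "merge_path G m (cw_verts ?u) (label_classes s \<union> label_classes t) (label_classes ?u)"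
  proof (rule merge_path_coarsening)
    show "partition_on (cw_verts ?u) (label_classes s \<union> label_classes t)"
      using partition_on_disjoint_Un[OF label_classes_partition_on label_classes_partition_on dj] by simp
    show "finite (label_classes s \<union> label_classes t)" using label_classes_card k by blast
    show "card (label_classes s \<union> label_classes t) \<le> Suc m"
      using card_Un_le[of "label_classes s" "label_classes t"]
        label_classes_card(1)[OF k(1)] label_classes_card(1)[OF k(2)] m by linarith
    show "\<exists>X'\<in>label_classes ?u. X \<subseteq> X'" if X: "X \<in> label_classes s \<union> label_classes t" for X
    proof -
      obtain v where "v \<in> ?S \<and> X = {u \<in> ?S. cw_label s u = cw_label s v} \<or>
        v \<in> ?T \<and> X = {u \<in> ?T. cw_label t u = cw_label t v}"
        using X by (auto simp: label_classes_def)
      then have "v \<in> cw_verts ?u" "X \<subseteq> {u \<in> cw_verts ?u. cw_label ?u u = cw_label ?u v}"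
        using dj by auto
      then show ?thesis unfolding label_classes_def by blast
    qed
  qed (use label_classes_partition_on[of ?u] label_classes_outward_homogeneous[OF Disjoint_Union.prems(2)]
    in blast)+
  moreover have "singletons ?S \<union> singletons ?T = singletons (?S \<union> ?T)"
    by (auto simp: singletons_def)
  ultimately show ?case by (metis cw_verts.simps(2) merge_path_trans)
next
  \<comment> \<open>A join changes neither vertices nor labels, and its arcs belong to
    \<open>G\<close> from the start, so the same path serves.\<close>
  case (Join i j t)
  then have "merge_path G m (cw_verts t) (singletons (cw_verts t)) (label_classes t)"
    using cw_embedded_Join by auto
  then show ?case by (simp add: label_classes_def)
next
  case (Relabel i j t)
  let ?u = "Relabel i j t"
  have k: "k_expression k t" using Relabel.prems by simp
  have "merge_path G m (cw_verts t) (singletons (cw_verts t)) (label_classes t)"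
    using Relabel.IH k cw_embedded_Relabel[OF Relabel.prems(2)] by blast
  moreover have "merge_path G m (cw_verts ?u) (label_classes t) (label_classes ?u)"
  proof (rule merge_path_coarsening)
    show "partition_on (cw_verts ?u) (label_classes t)"
      using label_classes_partition_on[of t] by simp
    show "finite (label_classes t)" using label_classes_card k by blast
    show "card (label_classes t) \<le> Suc m" using label_classes_card(1)[OF k] m by linarith
    show "\<exists>X'\<in>label_classes ?u. X \<subseteq> X'" if "X \<in> label_classes t" for X
      using that by (auto simp: label_classes_def)
  qed (use label_classes_partition_on[of ?u] label_classes_outward_homogeneous[OF Relabel.prems(2)]
    in blast)+
  ultimately show ?case by (metis cw_verts.simps(4) merge_path_trans)
qed

text \<open>Besides bounding \<open>ctww\<close>, this provides the existence of a partition
  sequence.\<close>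

lemma k_expression_partition_sequence:
  assumes G: "pair_graph G" and t: "k_expression k t" "cw_graph t = G"
  shows "\<exists>\<P>. partition_sequence G \<P> \<and>
    (\<forall>i\<in>{1..card (pverts G)}. max_red_component G (\<P> i) < 2 * k)"
proof -
  let ?V = "pverts G"
  define m where "m = 2 * k - 1"
  have m: "2 * k = Suc m" "m \<ge> 1" using k_expression_pos[OF t(1)] by (auto simp: m_def)
  have V: "cw_verts t = ?V" using t(2) by (auto simp: cw_graph_def)
  have emb: "cw_embedded G t" using cw_embedded_self[of t] t(2) by simp
  have fV: "finite ?V" using pair_graph_finite[OF G] .
  have lc: "partition_on ?V (label_classes t)" using label_classes_partition_on[of t] V by simp
  have ne: "?V \<noteq> {}" using V by (induction t) auto
  have "merge_path G m ?V (singletons ?V) (label_classes t)"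
    using merge_path_label_classes[OF G m(1) t(1) emb] V by simp
  \<comment> \<open>The remaining at most \<open>k\<close> classes are merged in any order: no
    vertex lies outside \<open>?V\<close>, so homogeneity is vacuous.\<close>
  moreover have "merge_path G m ?V (label_classes t) {?V}"
  proof (rule merge_path_coarsening)
    show "partition_on ?V {?V}" using ne by (rule partition_on_space)
    show "\<And>X. X \<in> {?V} \<Longrightarrow> outward_homogeneous G ?V X" by (auto simp: outward_homogeneous_def)
    show "card (label_classes t) \<le> Suc m" using label_classes_card(1)[OF t(1)] m by linarith
    show "\<exists>X'\<in>{?V}. X \<subseteq> X'" if "X \<in> label_classes t" for X
      using lc that by (auto simp: partition_on_def)
  qed (use lc label_classes_card(2)[OF t(1)] in blast)+
  ultimately have path: "merge_path G m ?V (singletons ?V) {?V}" by (rule merge_path_trans)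
  have "singletons ?V = (\<lambda>v. {v}) ` ?V" by (auto simp: singletons_def)
  then have card: "card (singletons ?V) = card ?V" by (simp add: card_image)
  obtain \<P> where \<P>: "\<P> (card ?V) = singletons ?V" "\<P> 1 = {?V}"
    "\<And>i. i \<in> {1..card ?V} \<Longrightarrow> admissible G m ?V (\<P> i)"
    "\<And>i. i \<in> {1..<card ?V} \<Longrightarrow> merges_to (\<P> (i + 1)) (\<P> i)"
    using merge_path_partition_sequence[OF path singletons_admissible[OF m(2)] fV] card by metis
  have "partition_sequence G \<P>"
    unfolding partition_sequence_def
  proof (intro conjI ballI)
    show "partition_on ?V (\<P> i)" if "i \<in> {1..card ?V}" for i
      using \<P>(3)[OF that] by (simp add: admissible_def)
    show "\<exists>X\<in>\<P> (i + 1). \<exists>Y\<in>\<P> (i + 1). X \<noteq> Y \<and> \<P> i = \<P> (i + 1) - {X, Y} \<union> {X \<union> Y}"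
      if "i \<in> {1..<card ?V}" for i
      using \<P>(4)[OF that] by (simp only: merges_to_def)
  qed (use \<P>(1,2) in \<open>simp_all add: singletons_def\<close>)
  moreover have "max_red_component G (\<P> i) < 2 * k" if i: "i \<in> {1..card ?V}" for i
  proof -
    have "partition_on ?V (\<P> i)" using \<P>(3)[OF i] by (simp add: admissible_def)
    then have "finite (\<P> i)" and "\<Union> (\<P> i) = ?V"
      by (rule partition_on_finite[OF fV], simp add: partition_on_def)
    moreover from this have "\<P> i \<noteq> {}" using ne by force
    ultimately have "max_red_component G (\<P> i) \<le> m"
      using admissible_max_red_component[OF G \<P>(3)[OF i]] by blast
    then show ?thesis using m(1) by linarith
  qed
  ultimately show ?thesis by blast
qed

lemma ctww_less_k_expression:
  assumes G: "pair_graph G" "pverts G \<noteq> {}" and t: "k_expression k t" "cw_graph t = G"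
  shows "ctww G < 2 * k"
proof -
  obtain \<P> where \<P>: "partition_sequence G \<P>"
    and less: "\<And>i. i \<in> {1..card (pverts G)} \<Longrightarrow> max_red_component G (\<P> i) < 2 * k"
    using k_expression_partition_sequence[OF G(1) t] by blast
  have "ctww G \<le> (MAX i\<in>{1..card (pverts G)}. max_red_component G (\<P> i))"
    unfolding ctww_def using \<P> by (intro cINF_lower) auto
  also have "\<dots> < 2 * k"
    using less G(2) pair_graph_finite[OF G(1)] by (simp add: Suc_leI card_gt_0_iff)
  finally show ?thesis .
qed

section \<open>Existence of clique-width expressions\<close>

lemma edgeless_k_expression:
  assumes "finite W" "W \<noteq> {}" "\<forall>v\<in>W. f v \<in> {1..k}"
  shows "\<exists>t. k_expression k t \<and> cw_verts t = W \<and> cw_arcs t = {} \<and> (\<forall>v\<in>W. cw_label t v = f v)"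
  using assms
proof (induction rule: finite_ne_induct)
  case (singleton v)
  then show ?case by (intro exI[of _ "Vertex v (f v)"]) auto
next
  case (insert v W)
  then obtain t where "k_expression k t" "cw_verts t = W" "cw_arcs t = {}"
    "\<forall>v\<in>W. cw_label t v = f v" by auto
  then show ?case using insert by (intro exI[of _ "Disjoint_Union (Vertex v (f v)) t"]) auto
qed

text \<open>With a private label for every vertex, each join adds a single edge. Existence makes the
  infimum in \<open>clique_width\<close> attained.\<close>

lemma ex_k_expression:
  assumes G: "pair_graph G" and ne: "pverts G \<noteq> {}"
  shows "\<exists>k t. k_expression k t \<and> cw_graph t = G"
proof -
  let ?V = "pverts G" and ?k = "card (pverts G)"
  have fV: "finite ?V" using pair_graph_finite[OF G] .
  obtain f where f: "bij_betw f ?V {1..?k}"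
    using ex_bij_betw_finite_nat[OF fV] ex_bij_betw_nat_finite_1[OF fV] bij_betw_inv by blast
  have f_range: "f v \<in> {1..?k}" if "v \<in> ?V" for v using f that by (auto dest: bij_betwE)
  have f_inj: "f u = f v \<longleftrightarrow> u = v" if "u \<in> ?V" "v \<in> ?V" for u v
    using f that by (meson bij_betw_imp_inj_on inj_on_eq_iff)
  have fin: "finite (parcs G)" using pair_graph_arcs[OF G] fV by (meson finite_SigmaI finite_subset)
  \<comment> \<open>The induction adds arcs one at a time, but a join creates both directions, hence
    the symmetric closure of \<open>F\<close>.\<close>
  have edges: "\<exists>t. k_expression ?k t \<and> cw_verts t = ?V \<and> cw_arcs t = F \<union> F\<inverse> \<and>
      (\<forall>v\<in>?V. cw_label t v = f v)" if "finite F" "F \<subseteq> parcs G" for F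
    using that
  proof (induction rule: finite_induct)
    case empty
    then show ?case using edgeless_k_expression[OF fV ne, of f ?k] f_range by simp
  next
    case (insert e F)
    obtain a b where e: "e = (a, b)" by (cases e)
    have ab: "a \<in> ?V" "b \<in> ?V" "a \<noteq> b"
      using insert.prems e pair_graph_arcs[OF G] pair_graph_no_loop[OF G] by auto
    obtain t where t: "k_expression ?k t" "cw_verts t = ?V" "cw_arcs t = F \<union> F\<inverse>"
      "\<forall>v\<in>?V. cw_label t v = f v" using insert by auto
    have "cw_arcs (Join (f a) (f b) t) = cw_arcs t \<union> {(a, b), (b, a)}"
      using t(2,4) ab f_inj by auto
    then have "cw_arcs (Join (f a) (f b) t) = insert e F \<union> (insert e F)\<inverse>"
      using t(3) e by auto
    moreover have "k_expression ?k (Join (f a) (f b) t)"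
      using t(1) ab f_inj f_range by simp
    ultimately show ?case using t by (intro exI[of _ "Join (f a) (f b) t"]) simp
  qed
  obtain t where t: "k_expression ?k t" "cw_verts t = ?V"
    "cw_arcs t = parcs G \<union> (parcs G)\<inverse>" using edges[OF fin] by auto
  have "parcs G \<union> (parcs G)\<inverse> = parcs G" using pair_graph_arc_sym[OF G] by auto
  then have "cw_graph t = G" using t by (simp add: cw_graph_def)
  then show ?thesis using t(1) by blast
qed

section \<open>The two inequalities\<close>

theorem theorem1:
  fixes G :: "'a pair_pre_digraph"
  assumes "pair_graph G" and "pverts G \<noteq> {}"
  shows "int (stw G) \<le> int (ctww G) - 1 \<and>
         int (stw G) \<le> 2 * (int (clique_width G) - 1)"
proof -
  have "clique_width G \<in> {k. \<exists>t. k_expression k t \<and> cw_graph t = G}"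
    unfolding clique_width_def by (rule Inf_nat_def1) (use ex_k_expression[OF assms] in auto)
  then obtain t where t: "k_expression (clique_width G) t" "cw_graph t = G" by blast
  have "stw G < ctww G"
    using stw_less_ctww[OF assms] k_expression_partition_sequence[OF assms(1) t] by blast
  moreover have "ctww G < 2 * clique_width G" using ctww_less_k_expression[OF assms t] .
  \<comment> \<open>Two strict inequalities in a chain of naturals give the gap of 2 below
    \<open>2 * clique_width G\<close>. Stated additively, the bounds pass to the integers without
    truncated subtraction.\<close>
  ultimately have "stw G + 1 \<le> ctww G" "stw G + 2 \<le> 2 * clique_width G" by linarith+
  then have "int (stw G) + 1 \<le> int (ctww G)" "int (stw G) + 2 \<le> 2 * int (clique_width G)"
    by linarith+
  then show ?thesis by simp
qed

end
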